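(* Let $(X,\mathbb{F})$ be a non-autonomous system generated by a sequence $\mathbb{F}=(f_n)$ commuting with a map $f$, and suppose $(f_n)$ converges strongly to $f$. Let $x,y\in X$. If $(x,y)$ is syndetically proximal for $(X,f)$, then $(x,y)$ is syndetically proximal for $(X,\mathbb{F})$. Further, if $(X,\mathbb{F})$ is pointwise asymptotically commutative and $\mathbb{F}$ is a family of homeomorphisms, then the converse is also true: if $(x,y)$ is syndetically proximal for $(X,\mathbb{F})$, then $(x,y)$ is syndetically proximal for $(X,f)$.
   Context: A non-autonomous system $(X,\mathbb{F})$ consists of a compact metric space $(X,d_X)$ and a sequence $\mathbb{F}=(f_n)_{n\ge 1}$ of surjective continuous self-maps of $X$; $\omega_n=f_n\circ\cdots\circ f_1$. $\mathbb{F}$ commutes with $f$ if $f_n\circ f=f\circ f_n$ for all $n$. $(X,f)$ denotes the autonomous system, for which $\omega_n=f^n$. $D_{C(X)}(g,h)=\sup_{x\in X}d_X(g(x),h(x))$ for continuous self-maps $g,h$ of $X$. $(f_n)$ converges strongly to the continuous map $f:X\to X$ if $\sum_{n=1}^\infty D_{C(X)}(f_n,f)<\infty$. A set $S=\{s_n:n\in\mathbb{N}\}\subseteq\mathbb{N}$ (with $s_1<s_2<\cdots$) is syndetic if there is $M\in\mathbb{N}$ with $|s_{n+1}-s_n|\le M$ for all $n$. A pair $(x,y)$ is syndetically proximal for a system if for every $\epsilon>0$ the set $\{n\in\mathbb{N}: d_X(\omega_n(x),\omega_n(y))<\epsilon\}$ is syndetic. $(X,\mathbb{F})$ is pointwise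 asymptotically commutative if $\lim_{n\to\infty}d_X(\omega_n\circ\omega_r(x),\omega_r\circ\omega_n(x))=0$ for every $x\in X$ and $r\in\mathbb{N}$. *)

theory Defs
  imports "HOL-Analysis.Analysis"
begin

text \<open>
  Spaces are compact subsets \<open>X\<close> of a metric space type, with the induced metric; maps of \<open>X\<close> are
  total functions that are only constrained on \<open>X\<close>. A sequence of maps \<open>(f\<^sub>n)\<close> with \<open>n \<ge> 1\<close> is a
  function \<open>F\<close> on \<open>nat\<close> whose value \<open>F 0\<close> is never used.
\<close>

primrec omega :: "(nat \<Rightarrow> 'a \<Rightarrow> 'a) \<Rightarrow> nat \<Rightarrow> 'a \<Rightarrow> 'a" where
  "omega F 0 = id"
| "omega F (Suc n) = F (Suc n) \<circ> omega F n"

lemma omega_const: "omega (\<lambda>_. f) n = f ^^ n"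
  by (induction n) simp_all

definition nonautonomous_system :: "'a::metric_space set \<Rightarrow> (nat \<Rightarrow> 'a \<Rightarrow> 'a) \<Rightarrow> bool" where
  "nonautonomous_system X F \<longleftrightarrow>
     compact X \<and> (\<forall>n\<ge>1. continuous_on X (F n) \<and> F n ` X = X)"

definition commutes_with :: "'a set \<Rightarrow> (nat \<Rightarrow> 'a \<Rightarrow> 'a) \<Rightarrow> ('a \<Rightarrow> 'a) \<Rightarrow> bool" where
  "commutes_with X F f \<longleftrightarrow> (\<forall>n\<ge>1. \<forall>z\<in>X. F n (f z) = f (F n z))"

text \<open>
  For continuous self-maps of a nonempty compact \<open>X\<close> the supremum is taken over a nonempty
  bounded set of reals, so it is the usual one.
\<close>

definition sup_dist :: "'a::metric_space set \<Rightarrow> ('a \<Rightarrow> 'a) \<Rightarrow> ('a \<Rightarrow> 'a) \<Rightarrow> real" where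
  "sup_dist X g h = (SUP z\<in>X. dist (g z) (h z))"

definition converges_strongly :: "'a::metric_space set \<Rightarrow> (nat \<Rightarrow> 'a \<Rightarrow> 'a) \<Rightarrow> ('a \<Rightarrow> 'a) \<Rightarrow> bool" where
  "converges_strongly X F f \<longleftrightarrow>
     continuous_on X f \<and> f ` X \<subseteq> X \<and> summable (\<lambda>n. sup_dist X (F (Suc n)) f)"

text \<open>
  The enumeration is indexed from 0 rather than from 1. Being strictly increasing, it
  makes the set infinite and the subtraction of natural numbers exact.
\<close>

definition syndetic :: "nat set \<Rightarrow> bool" where
  "syndetic S \<longleftrightarrow>
     (\<exists>s. strict_mono s \<and> S = range s \<and> (\<exists>M. \<forall>n. s (Suc n) - s n \<le> M))"

definition syndetically_proximal :: "(nat \<Rightarrow> 'a::metric_space \<Rightarrow> 'a) \<Rightarrow> 'a \<Rightarrow> 'a \<Rightarrow> bool" where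
  "syndetically_proximal F x y \<longleftrightarrow>
     (\<forall>\<epsilon>>0. syndetic {n. n \<ge> 1 \<and> dist (omega F n x) (omega F n y) < \<epsilon>})"

definition pointwise_asymptotically_commutative ::
    "'a::metric_space set \<Rightarrow> (nat \<Rightarrow> 'a \<Rightarrow> 'a) \<Rightarrow> bool" where
  "pointwise_asymptotically_commutative X F \<longleftrightarrow>
     (\<forall>z\<in>X. \<forall>r\<ge>1.
        (\<lambda>n. dist (omega F n (omega F r z)) (omega F r (omega F n z))) \<longlonglongrightarrow> 0)"

definition family_of_homeomorphisms :: "'a::metric_space set \<Rightarrow> (nat \<Rightarrow> 'a \<Rightarrow> 'a) \<Rightarrow> bool" where
  "family_of_homeomorphisms X F \<longleftrightarrow> (\<forall>n\<ge>1. \<exists>g. homeomorphism X X (F n) g)"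

end

theory Submission
  imports Defs
begin

text \<open>
  Since \<open>F\<close> commutes with \<open>f\<close>, the orbit of \<open>z\<close> under \<open>F\<close> from time \<open>n\<close> on stays within the tail
  \<open>\<Sum>j>n. D(f\<^sub>j, f)\<close> of the \<open>f\<close>-orbit of \<open>\<omega>\<^sub>n z\<close>, and \<open>f\<^sup>k \<circ> \<omega>\<^sub>n = \<omega>\<^sub>n \<circ> f\<^sup>k\<close>. Hence closeness of
  \<open>f\<^sup>k x\<close> and \<open>f\<^sup>k y\<close> gives closeness of \<open>\<omega>\<^bsub>n+k\<^esub> x\<close> and \<open>\<omega>\<^bsub>n+k\<^esub> y\<close> for a fixed large \<open>n\<close>.
  For the converse one cannot invert \<open>\<omega>\<^sub>n\<close> along this estimate, as the modulus of continuity of the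
  inverse may beat the tail. Instead the estimate is applied to \<open>\<omega>\<^sub>r\<^sup>-\<^sup>1 x\<close> and \<open>\<omega>\<^sub>r\<^sup>-\<^sup>1 y\<close>, whose orbits
  shadow \<open>f\<^sup>k x\<close> and \<open>f\<^sup>k y\<close>; asymptotic commutativity shows that \<open>\<omega>\<^sub>n \<omega>\<^sub>r\<^sup>-\<^sup>1 x\<close> is asymptotic to
  \<open>\<omega>\<^sub>r\<^sup>-\<^sup>1 \<omega>\<^sub>n x\<close>, so only the modulus of continuity for one fixed \<open>r\<close> is needed.
\<close>

section \<open>Syndetic sets of times\<close>

text \<open>Bounded gaps mean that every window of one fixed length meets \<open>S\<close>; this
  form avoids handling enumerations later.\<close>

lemma syndetic_iff: "syndetic S \<longleftrightarrow> (\<exists>M. \<forall>n. \<exists>m\<in>S. n \<le> m \<and> m \<le> n + M)"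
proof
  assume "syndetic S"
  then obtain s M where s: "strict_mono s" "S = range s" and M: "\<And>n. s (Suc n) - s n \<le> M"
    unfolding syndetic_def by blast
  \<comment> \<open>Take the first \<open>s i\<close> that reaches \<open>n\<close>. If
    \<open>i = 0\<close>, the summand \<open>s 0\<close> covers it; otherwise its predecessor lies
    below \<open>n\<close> and the gap bound applies.\<close>
  have "\<exists>m\<in>S. n \<le> m \<and> m \<le> n + (M + s 0)" for n
  proof -
    have ex: "n \<le> s n"
      using s(1) by (rule strict_mono_imp_increasing)
    define i where "i = (LEAST i. n \<le> s i)"
    have i: "n \<le> s i"
      unfolding i_def using ex by (rule LeastI)
    have "s i \<le> n + (M + s 0)"
    proof (cases i)
      case (Suc j)
      then have "\<not> n \<le> s j"
        using not_less_Least[of j "\<lambda>i. n \<le> s i"] by (simp add: i_def)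
      then show ?thesis
        using M[of j] Suc by simp
    qed simp
    then show ?thesis
      using i s(2) by blast
  qed
  then show "\<exists>M. \<forall>n. \<exists>m\<in>S. n \<le> m \<and> m \<le> n + M"
    by blast
next
  assume "\<exists>M. \<forall>n. \<exists>m\<in>S. n \<le> m \<and> m \<le> n + M"
  then obtain M where M: "\<And>n. \<exists>m\<in>S. n \<le> m \<and> m \<le> n + M"
    by blast
  then have inf: "infinite S"
    unfolding infinite_nat_iff_unbounded_le by blast
  have "enumerate S (Suc n) - enumerate S n \<le> Suc M" for n
  proof -
    obtain m where m: "m \<in> S" "Suc (enumerate S n) \<le> m" "m \<le> Suc (enumerate S n) + M"
      using M by blast
    then have "enumerate S (Suc n) \<le> m"
      unfolding enumerate_Suc''[OF inf] by (intro Least_le) simp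
    then show ?thesis
      using m by simp
  qed
  moreover have "strict_mono (enumerate S)" "S = range (enumerate S)"
    using inf by (simp_all add: strict_mono_enumerate range_enumerate)
  ultimately show "syndetic S"
    unfolding syndetic_def by blast
qed

text \<open>Here \<open>c\<close> allows for a time shift between the two systems and
  \<open>N\<close> for finitely many exceptional times. Both only lengthen the windows.\<close>

lemma syndetic_eventually_near:
  assumes "syndetic S" and near: "\<And>m. m \<in> S \<Longrightarrow> N \<le> m \<Longrightarrow> \<exists>t\<in>T. m \<le> t + c \<and> t \<le> m + c"
  shows "syndetic T"
proof -
  obtain M where M: "\<And>n. \<exists>m\<in>S. n \<le> m \<and> m \<le> n + M"
    using assms(1) unfolding syndetic_iff by blast
  have "\<exists>t\<in>T. n \<le> t \<and> t \<le> n + (N + 2 * c + M)" for n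
  proof -
    obtain m where m: "m \<in> S" "n + N + c \<le> m" "m \<le> n + N + c + M"
      using M by blast
    then obtain t where "t \<in> T" "m \<le> t + c" "t \<le> m + c"
      using near[of m] by auto
    then show ?thesis
      using m by (intro bexI[of _ t]) auto
  qed
  then show ?thesis
    unfolding syndetic_iff by blast
qed

section \<open>Compositions and the supremum distance\<close>

lemma funpow_mem: "(\<And>z. z \<in> X \<Longrightarrow> f z \<in> X) \<Longrightarrow> z \<in> X \<Longrightarrow> (f ^^ k) z \<in> X"
  by (induction k) auto

lemma nonautonomous_system_mem:
  "nonautonomous_system X F \<Longrightarrow> 1 \<le> n \<Longrightarrow> z \<in> X \<Longrightarrow> F n z \<in> X"
  unfolding nonautonomous_system_def by blast

lemma omega_mem: "nonautonomous_system X F \<Longrightarrow> z \<in> X \<Longrightarrow> omega F n z \<in> X"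
  by (induction n) (simp_all add: nonautonomous_system_mem)

lemma continuous_on_omega:
  assumes "nonautonomous_system X F"
  shows "continuous_on X (omega F n)"
proof (induction n)
  case (Suc n)
  have "continuous_on X (F (Suc n))"
    using assms unfolding nonautonomous_system_def by simp
  moreover have "omega F n ` X \<subseteq> X"
    using assms by (auto intro: omega_mem)
  ultimately have "continuous_on (omega F n ` X) (F (Suc n))"
    by (rule continuous_on_subset)
  then show ?case
    unfolding omega.simps by (rule continuous_on_compose[OF Suc])
qed simp

lemma homeomorphism_omega:
  assumes "family_of_homeomorphisms X F"
  shows "\<exists>g. homeomorphism X X (omega F n) g"
proof (induction n)
  case 0
  then show ?case
    using homeomorphism_ident[of X] by (auto simp: id_def)
next
  case (Suc n)
  moreover have "\<exists>g. homeomorphism X X (F (Suc n)) g"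
    using assms unfolding family_of_homeomorphisms_def by simp
  ultimately show ?case
    unfolding omega.simps by (blast intro: homeomorphism_compose)
qed

lemma sup_dist_upper:
  assumes "compact X" "continuous_on X g" "continuous_on X h" "z \<in> X"
  shows "dist (g z) (h z) \<le> sup_dist X g h"
proof -
  have "compact ((\<lambda>z. dist (g z) (h z)) ` X)"
    using assms by (intro compact_continuous_image continuous_on_dist)
  then have "bdd_above ((\<lambda>z. dist (g z) (h z)) ` X)"
    by (intro bounded_imp_bdd_above compact_imp_bounded)
  then show ?thesis
    unfolding sup_dist_def using assms(4) by (intro cSUP_upper)
qed

section \<open>Shadowing of orbits\<close>

context
  fixes X :: "'a::metric_space set" and F :: "nat \<Rightarrow> 'a \<Rightarrow> 'a" and f :: "'a \<Rightarrow> 'a"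
  assumes sys: "nonautonomous_system X F"
    and comm: "commutes_with X F f"
    and conv: "converges_strongly X F f"
begin

lemma limit_mem: "z \<in> X \<Longrightarrow> f z \<in> X"
  using conv unfolding converges_strongly_def by blast

lemma map_funpow_commute:
  assumes "1 \<le> n" "z \<in> X"
  shows "F n ((f ^^ k) z) = (f ^^ k) (F n z)"
proof (induction k)
  case (Suc k)
  have "(f ^^ k) z \<in> X"
    using assms(2) by (intro funpow_mem limit_mem)
  then show ?case
    using Suc comm assms(1) by (simp add: commutes_with_def)
qed simp

lemma omega_funpow_commute:
  assumes "z \<in> X"
  shows "omega F n ((f ^^ k) z) = (f ^^ k) (omega F n z)"
  by (induction n) (simp_all add: map_funpow_commute omega_mem[OF sys] assms)

text \<open>Induction on \<open>k\<close> replaces the first map \<open>F (Suc n)\<close> by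
  \<open>f\<close> and treats the rest as an orbit starting at time \<open>Suc n\<close>.\<close>

lemma orbit_shadowing:
  assumes "z \<in> X"
  shows "dist (omega F (n + k) z) ((f ^^ k) (omega F n z))
    \<le> (\<Sum>j=n..<n + k. sup_dist X (F (Suc j)) f)"
proof (induction k arbitrary: n)
  case (Suc k)
  define w where "w = omega F n z"
  have w: "w \<in> X" "(f ^^ k) w \<in> X"
    using assms by (auto simp: w_def intro: omega_mem[OF sys] funpow_mem limit_mem)
  \<comment> \<open>Commutativity moves \<open>F (Suc n)\<close> outside \<open>f ^^ k\<close>, so
    the error of one replacement is not amplified by the iterates of \<open>f\<close>.\<close>
  have "dist ((f ^^ k) (F (Suc n) w)) ((f ^^ Suc k) w)
      = dist (F (Suc n) ((f ^^ k) w)) (f ((f ^^ k) w))"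
    using w by (simp add: map_funpow_commute)
  also have "\<dots> \<le> sup_dist X (F (Suc n)) f"
    using sys conv w(2)
    by (intro sup_dist_upper) (auto simp: nonautonomous_system_def converges_strongly_def)
  finally have "dist ((f ^^ k) (F (Suc n) w)) ((f ^^ Suc k) w) \<le> sup_dist X (F (Suc n)) f" .
  moreover have "dist (omega F (n + Suc k) z) ((f ^^ k) (F (Suc n) w))
      \<le> (\<Sum>j=Suc n..<n + Suc k. sup_dist X (F (Suc j)) f)"
    using Suc.IH[of "Suc n"] by (simp add: w_def)
  ultimately have "dist (omega F (n + Suc k) z) ((f ^^ Suc k) w)
      \<le> sup_dist X (F (Suc n)) f + (\<Sum>j=Suc n..<n + Suc k. sup_dist X (F (Suc j)) f)"
    using dist_triangle[of "omega F (n + Suc k) z" "(f ^^ Suc k) w" "(f ^^ k) (F (Suc n) w)"]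
    by linarith
  also have "\<dots> = (\<Sum>j=n..<n + Suc k. sup_dist X (F (Suc j)) f)"
    by (rule sum.atLeast_Suc_lessThan[symmetric]) simp
  finally show ?case
    unfolding w_def .
qed simp

lemma uniform_orbit_shadowing:
  assumes "\<epsilon> > 0"
  obtains n where "1 \<le> n"
    and "\<And>k z. z \<in> X \<Longrightarrow> dist (omega F (n + k) z) ((f ^^ k) (omega F n z)) < \<epsilon>"
proof -
  have "summable (\<lambda>j. sup_dist X (F (Suc j)) f)"
    using conv unfolding converges_strongly_def by blast
  then obtain N where
    N: "\<And>m n. N \<le> m \<Longrightarrow> norm (\<Sum>j=m..<n. sup_dist X (F (Suc j)) f) < \<epsilon>"
    using assms unfolding summable_Cauchy by meson
  \<comment> \<open>Starting at \<open>Suc N\<close> rather than \<open>N\<close> makes the index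
    positive, as asymptotic commutativity requires of \<open>r\<close>.\<close>
  have "dist (omega F (Suc N + k) z) ((f ^^ k) (omega F (Suc N) z)) < \<epsilon>" if "z \<in> X" for k z
    using orbit_shadowing[OF that, of "Suc N" k] N[of "Suc N" "Suc N + k"] by simp
  then show ?thesis
    using that[of "Suc N"] by simp
qed

section \<open>The two implications\<close>

lemma syndetically_proximal_limit_imp:
  assumes x: "x \<in> X" and y: "y \<in> X" and prox: "syndetically_proximal (\<lambda>_. f) x y"
  shows "syndetically_proximal F x y"
  unfolding syndetically_proximal_def
proof (intro allI impI)
  fix \<epsilon> :: real
  assume "\<epsilon> > 0"
  then obtain n where n: "1 \<le> n"
    and shadow: "\<And>k z. z \<in> X \<Longrightarrow> dist (omega F (n + k) z) ((f ^^ k) (omega F n z)) < \<epsilon> / 3"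
    using uniform_orbit_shadowing[of "\<epsilon> / 3"] by auto
  have "uniformly_continuous_on X (omega F n)"
    using sys continuous_on_omega[OF sys]
    by (intro compact_uniformly_continuous) (auto simp: nonautonomous_system_def)
  \<comment> \<open>Since \<open>n\<close> is already fixed, \<delta> serves for all times
    \<open>k\<close>.\<close>
  then obtain \<delta> where \<delta>: "\<delta> > 0"
    "\<And>u v. u \<in> X \<Longrightarrow> v \<in> X \<Longrightarrow> dist u v < \<delta> \<Longrightarrow> dist (omega F n u) (omega F n v) < \<epsilon> / 3"
    using \<open>\<epsilon> > 0\<close> unfolding uniformly_continuous_on_def by (metis divide_pos_pos zero_less_numeral)
  have "syndetic {k. k \<ge> 1 \<and> dist ((f ^^ k) x) ((f ^^ k) y) < \<delta>}"
    using prox \<delta>(1) by (simp add: syndetically_proximal_def omega_const)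
  then show "syndetic {k. k \<ge> 1 \<and> dist (omega F k x) (omega F k y) < \<epsilon>}"
  proof (rule syndetic_eventually_near[where c = n and N = 0])
    fix k
    assume "k \<in> {k. k \<ge> 1 \<and> dist ((f ^^ k) x) ((f ^^ k) y) < \<delta>}"
    then have "dist (omega F n ((f ^^ k) x)) (omega F n ((f ^^ k) y)) < \<epsilon> / 3"
      using x y by (intro \<delta>(2)) (auto intro: funpow_mem limit_mem)
    then have "dist ((f ^^ k) (omega F n x)) ((f ^^ k) (omega F n y)) < \<epsilon> / 3"
      using x y by (simp add: omega_funpow_commute)
    then have "dist (omega F (n + k) x) (omega F (n + k) y) < \<epsilon>"
      using shadow[OF x, of k] shadow[OF y, of k] by metric
    then show "\<exists>t\<in>{k. k \<ge> 1 \<and> dist (omega F k x) (omega F k y) < \<epsilon>}. k \<le> t + n \<and> t \<le> k + n"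
      using n by (intro bexI[of _ "n + k"]) auto
  qed
qed

lemma syndetically_proximal_imp_limit:
  assumes x: "x \<in> X" and y: "y \<in> X" and prox: "syndetically_proximal F x y"
    and pac: "pointwise_asymptotically_commutative X F"
    and homeo: "family_of_homeomorphisms X F"
  shows "syndetically_proximal (\<lambda>_. f) x y"
  unfolding syndetically_proximal_def omega_const
proof (intro allI impI)
  fix \<epsilon> :: real
  assume "\<epsilon> > 0"
  then obtain r where r: "1 \<le> r"
    and shadow: "\<And>k z. z \<in> X \<Longrightarrow> dist (omega F (r + k) z) ((f ^^ k) (omega F r z)) < \<epsilon> / 3"
    using uniform_orbit_shadowing[of "\<epsilon> / 3"] by auto
  obtain g where g: "homeomorphism X X (omega F r) g"
    using homeomorphism_omega[OF homeo] by blast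
  have "uniformly_continuous_on X g"
    using sys g
    by (intro compact_uniformly_continuous) (auto simp: nonautonomous_system_def homeomorphism_def)
  then obtain \<delta> where \<delta>: "\<delta> > 0"
    "\<And>u v. u \<in> X \<Longrightarrow> v \<in> X \<Longrightarrow> dist u v < \<delta> \<Longrightarrow> dist (g u) (g v) < \<epsilon> / 3"
    using \<open>\<epsilon> > 0\<close> unfolding uniformly_continuous_on_def by (metis divide_pos_pos zero_less_numeral)
  have g_mem: "g z \<in> X" and omega_g: "omega F r (g z) = z" and g_omega: "g (omega F r z) = z"
    if "z \<in> X" for z
    using g that unfolding homeomorphism_def by blast+
  \<comment> \<open>Asymptotic commutativity is used at the point \<open>g z\<close>, where
    \<open>omega F r (g z) = z\<close>.\<close>
  have asym: "\<forall>\<^sub>F n in sequentially. dist (omega F n z) (omega F r (omega F n (g z))) < \<delta> / 3"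
    if "z \<in> X" for z
  proof -
    have "(\<lambda>n. dist (omega F n (omega F r (g z))) (omega F r (omega F n (g z)))) \<longlonglongrightarrow> 0"
      using pac r g_mem[OF that] unfolding pointwise_asymptotically_commutative_def by blast
    then show ?thesis
      using \<delta>(1) by (auto simp: omega_g[OF that] dest!: order_tendstoD(2)[where a = "\<delta> / 3"])
  qed
  obtain N where N: "\<And>n. N \<le> n \<Longrightarrow> dist (omega F n x) (omega F r (omega F n (g x))) < \<delta> / 3"
    "\<And>n. N \<le> n \<Longrightarrow> dist (omega F n y) (omega F r (omega F n (g y))) < \<delta> / 3"
    using eventually_conj[OF asym[OF x] asym[OF y]] unfolding eventually_sequentially by blast
  have "syndetic {n. n \<ge> 1 \<and> dist (omega F n x) (omega F n y) < \<delta> / 3}"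
    using prox \<delta>(1) unfolding syndetically_proximal_def by (meson divide_pos_pos zero_less_numeral)
  then show "syndetic {k. k \<ge> 1 \<and> dist ((f ^^ k) x) ((f ^^ k) y) < \<epsilon>}"
  \<comment> \<open>\<open>N\<close> waits for both asymptotic estimates, and \<open>Suc r\<close>
    ensures that \<open>n - r\<close> is at least 1.\<close>
  proof (rule syndetic_eventually_near[where c = r and N = "N + Suc r"])
    fix n
    assume n: "n \<in> {n. n \<ge> 1 \<and> dist (omega F n x) (omega F n y) < \<delta> / 3}" "N + Suc r \<le> n"
    define k where "k = n - r"
    have k: "n = r + k" "1 \<le> k"
      using n(2) by (auto simp: k_def)
    have mem: "omega F n (g x) \<in> X" "omega F n (g y) \<in> X"
      using x y by (simp_all add: g_mem omega_mem[OF sys])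
    have "dist (omega F n x) (omega F n y) < \<delta> / 3"
      using n(1) by blast
    then have "dist (omega F r (omega F n (g x))) (omega F r (omega F n (g y))) < \<delta>"
      using N[of n] n(2) dist_triangle_third[of _ "omega F n x" \<delta> "omega F n y"]
      by (simp add: dist_commute)
    then have "dist (g (omega F r (omega F n (g x)))) (g (omega F r (omega F n (g y)))) < \<epsilon> / 3"
      using mem by (intro \<delta>(2)) (auto intro: omega_mem[OF sys])
    then have "dist (omega F (r + k) (g x)) (omega F (r + k) (g y)) < \<epsilon> / 3"
      using mem by (simp add: g_omega k)
    \<comment> \<open>The orbit of \<open>g x\<close> passes through \<open>x\<close> at time
      \<open>r\<close>, so from there on it shadows the \<open>f\<close>-orbit of \<open>x\<close>;
      likewise for \<open>y\<close>.\<close>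
    moreover have "dist (omega F (r + k) (g x)) ((f ^^ k) x) < \<epsilon> / 3"
      "dist (omega F (r + k) (g y)) ((f ^^ k) y) < \<epsilon> / 3"
      using shadow[of "g x" k] shadow[of "g y" k] x y by (simp_all add: g_mem omega_g)
    ultimately have "dist ((f ^^ k) x) ((f ^^ k) y) < \<epsilon>"
      by metric
    then show "\<exists>t\<in>{k. k \<ge> 1 \<and> dist ((f ^^ k) x) ((f ^^ k) y) < \<epsilon>}. n \<le> t + r \<and> t \<le> n + r"
      using k by (intro bexI[of _ k]) auto
  qed
qed

end

theorem theorem5p1:
  fixes X :: "'a::metric_space set"
    and F :: "nat \<Rightarrow> 'a \<Rightarrow> 'a"
    and f :: "'a \<Rightarrow> 'a"
    and x y :: 'a
  assumes "nonautonomous_system X F"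
    and "commutes_with X F f"
    and "converges_strongly X F f"
    and "x \<in> X" and "y \<in> X"
  shows "(syndetically_proximal (\<lambda>_. f) x y \<longrightarrow> syndetically_proximal F x y) \<and>
         (pointwise_asymptotically_commutative X F \<and> family_of_homeomorphisms X F \<longrightarrow>
            syndetically_proximal F x y \<longrightarrow> syndetically_proximal (\<lambda>_. f) x y)"
  using assms syndetically_proximal_limit_imp[OF assms(1-3)]
    syndetically_proximal_imp_limit[OF assms(1-3)] by blast

end
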